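(* Let $f$, given by $f(x,y)=\langle Kx,y\rangle+g(x)-h(y)$, be as in the context, let $(x^0,y^0)\in X\times Y$, and set $\bar{x}^0=x^0$, $\bar{y}^0=y^0$ (i.e., $x^{-1}=x^0$ and $y^{-1}=y^0$). The iterate scheme $$y^{k+1}=\operatorname{argmax}_{y\in Y}\Big\{f(\bar{x}^k,y)-\frac{1}{2\sigma_k}\|y-y^k\|^2\Big\},\quad \bar{y}^{k+1}=y^{k+1}+\beta_k(y^{k+1}-y^k),$$ $$x^{k+1}=\operatorname{argmin}_{x\in X}\Big\{f(x,\bar{y}^{k+1})+\frac{1}{2\tau_k}\|x-x^k\|^2\Big\},\quad \bar{x}^{k+1}=x^{k+1}+\alpha_k(x^{k+1}-x^k)\qquad(k\in\mathbf{N})$$ is equivalent to the iterate scheme $$y^{k+1}=\operatorname{Prox}^{Y}_{\sigma_kh}(\sigma_kK\bar{x}^k+y^k),\quad \bar{y}^{k+1}=y^{k+1}+\beta_k(y^{k+1}-y^k),$$ $$x^{k+1}=\operatorname{Prox}^{X}_{\tau_kg}(-\tau_kK^{*}\bar{y}^{k+1}+x^k),\quad \bar{x}^{k+1}=x^{k+1}+\alpha_k(x^{k+1}-x^k)\qquad(k\in\mathbf{N}).$$ Moreover, for every $k\in\mathbf{N}$, $$(\forall x\in X)\quad\Big\langle\frac{x^k-x^{k+1}}{\tau_k}-K^{*}\bar{y}^{k+1},\,x-x^{k+1}\Big\rangle+g(x^{k+1})\le g(x),$$ $$(\forall y\in Y)\quad\Big\langle\frac{y^k-y^{k+1}}{\sigma_k}+K\bar{x}^k,\,y-y^{k+1}\Big\rangle+h(y^{k+1})\le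 h(y).$$
   Context: $\mathbf{N}$ is the set of nonnegative integers. $\mathcal{H}_1,\mathcal{H}_2$ are Hilbert spaces; $X\subseteq\mathcal{H}_1$ and $Y\subseteq\mathcal{H}_2$ are nonempty, closed and convex. $K:\mathcal{H}_1\to\mathcal{H}_2$ is a continuous linear operator with adjoint $K^{*}$. $g:\mathcal{H}_1\to\mathbf{R}\cup\{+\infty\}$ and $h:\mathcal{H}_2\to\mathbf{R}\cup\{+\infty\}$ are proper, convex and lower semicontinuous, and $f(x,y)=\langle Kx,y\rangle+g(x)-h(y)$ for all $(x,y)\in X\times Y$. Standing assumption: for every $y\in Y$, $f(\cdot,y)$ maps $X$ into $\mathbf{R}\cup\{+\infty\}$ and is proper, convex and lower semicontinuous; for every $x\in X$, $f(x,\cdot)$ maps $Y$ into $\mathbf{R}\cup\{-\infty\}$ and $-f(x,\cdot)$ is proper, convex and lower semicontinuous. $(\tau_k)_{k\in\mathbf{N}},(\sigma_k)_{k\in\mathbf{N}}$ are sequences of positive reals; $(\alpha_k)_{k\in\mathbf{N}\cup\{-1\}},(\beta_k)_{k\in\mathbf{N}}$ are sequences of nonnegative reals. For a nonempty closed convex set $C$ and a function $\varphi$, $\operatorname{Prox}^{C}_{\varphi}(v):=\operatorname{argmin}_{u\in C}\{\varphi(u)+\frac12\|u-v\|^2\}$.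
   Formalization: When an extrapolated point leaves X (or Y) and g (or h) is +∞ there, that infinite constant is replaced by 0 in f; otherwise f(x̄^k,·) or f(·,ȳ^{k+1}) would be constantly infinite and its argmax/argmin undetermined. *)

theory Defs
  imports "HOL-Analysis.Analysis"
begin

definition proper_on :: "'a set \<Rightarrow> ('a \<Rightarrow> ereal) \<Rightarrow> bool" where
  "proper_on C \<phi> \<longleftrightarrow> (\<forall>u\<in>C. \<phi> u \<noteq> - \<infinity>) \<and> (\<exists>u\<in>C. \<phi> u \<noteq> \<infinity>)"

(* Only used together with proper_on, so the sum on the right never has the form \<infinity> - \<infinity>. *)
definition ereal_convex_on :: "'a::real_vector set \<Rightarrow> ('a \<Rightarrow> ereal) \<Rightarrow> bool" where
  "ereal_convex_on C \<phi> \<longleftrightarrow> convex C \<and>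
     (\<forall>u\<in>C. \<forall>v\<in>C. \<forall>s t. 0 < s \<longrightarrow> 0 < t \<longrightarrow> s + t = 1 \<longrightarrow>
        \<phi> (s *\<^sub>R u + t *\<^sub>R v) \<le> ereal s * \<phi> u + ereal t * \<phi> v)"

definition lsc_on :: "'a::topological_space set \<Rightarrow> ('a \<Rightarrow> ereal) \<Rightarrow> bool" where
  "lsc_on C \<phi> \<longleftrightarrow> (\<forall>u\<in>C. \<phi> u \<le> Liminf (at u within C) \<phi>)"

definition proper_convex_lsc_on :: "'a::real_normed_vector set \<Rightarrow> ('a \<Rightarrow> ereal) \<Rightarrow> bool" where
  "proper_convex_lsc_on C \<phi> \<longleftrightarrow> proper_on C \<phi> \<and> ereal_convex_on C \<phi> \<and> lsc_on C \<phi>"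

definition finite_off :: "'a set \<Rightarrow> ('a \<Rightarrow> ereal) \<Rightarrow> 'a \<Rightarrow> ereal" where
  "finite_off C \<phi> u = (if u \<in> C \<or> \<bar>\<phi> u\<bar> \<noteq> \<infinity> then \<phi> u else 0)"

(* On X \<times> Y this is literally <K x, y> + g x - h y.  The schemes below also evaluate the coupling
   function at extrapolated points, which may lie outside X (resp. Y) and at which g (resp. h) may
   be infinite.  There g (resp. h) enters a subproblem only as an additive constant, so an infinite
   value outside X (resp. Y) is replaced by 0; otherwise the objective would be constantly infinite
   and the argmax (resp. argmin) would not be determined. *)
definition coupling ::
  "'a::real_inner set \<Rightarrow> 'b::real_inner set \<Rightarrow> ('a \<Rightarrow> 'b) \<Rightarrow> ('a \<Rightarrow> ereal) \<Rightarrow> ('b \<Rightarrow> ereal) \<Rightarrow> 'a \<Rightarrow> 'b \<Rightarrow> ereal"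
where
  "coupling X Y K g h x y = ereal (K x \<bullet> y) + finite_off X g x - finite_off Y h y"

lemma coupling_on:
  assumes "x \<in> X" and "y \<in> Y"
  shows "coupling X Y K g h x y = ereal (K x \<bullet> y) + g x - h y"
  using assms by (simp add: coupling_def finite_off_def)

lemma coupling_finite:
  assumes "\<bar>g x\<bar> \<noteq> \<infinity>" and "\<bar>h y\<bar> \<noteq> \<infinity>"
  shows "coupling X Y K g h x y = ereal (K x \<bullet> y) + g x - h y"
  using assms by (simp add: coupling_def finite_off_def)

definition convex_concave_on ::
  "'a::real_normed_vector set \<Rightarrow> 'b::real_normed_vector set \<Rightarrow> ('a \<Rightarrow> 'b \<Rightarrow> ereal) \<Rightarrow> bool" where
  "convex_concave_on X Y f \<longleftrightarrow>
     (\<forall>y\<in>Y. proper_convex_lsc_on X (\<lambda>x. f x y)) \<and>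
     (\<forall>x\<in>X. proper_convex_lsc_on Y (\<lambda>y. - f x y))"

definition Prox :: "'a::real_normed_vector set \<Rightarrow> ('a \<Rightarrow> ereal) \<Rightarrow> 'a \<Rightarrow> 'a" where
  "Prox C \<phi> v = arg_min_on (\<lambda>u. \<phi> u + ereal (1/2 * (norm (u - v))\<^sup>2)) C"

definition minimax_scheme ::
  "'a::real_inner set \<Rightarrow> 'b::real_inner set \<Rightarrow> ('a \<Rightarrow> 'b \<Rightarrow> ereal) \<Rightarrow>
   (nat \<Rightarrow> real) \<Rightarrow> (nat \<Rightarrow> real) \<Rightarrow> (nat \<Rightarrow> real) \<Rightarrow> (nat \<Rightarrow> real) \<Rightarrow>
   (nat \<Rightarrow> 'a) \<Rightarrow> (nat \<Rightarrow> 'a) \<Rightarrow> (nat \<Rightarrow> 'b) \<Rightarrow> (nat \<Rightarrow> 'b) \<Rightarrow> bool" where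
  "minimax_scheme X Y f \<tau> \<sigma> \<alpha> \<beta> x xbar y ybar \<longleftrightarrow> (\<forall>k.
     y (Suc k) = arg_max_on (\<lambda>v. f (xbar k) v - ereal (1 / (2 * \<sigma> k) * (norm (v - y k))\<^sup>2)) Y \<and>
     ybar (Suc k) = y (Suc k) + \<beta> k *\<^sub>R (y (Suc k) - y k) \<and>
     x (Suc k) = arg_min_on (\<lambda>u. f u (ybar (Suc k)) + ereal (1 / (2 * \<tau> k) * (norm (u - x k))\<^sup>2)) X \<and>
     xbar (Suc k) = x (Suc k) + \<alpha> k *\<^sub>R (x (Suc k) - x k))"

definition prox_scheme ::
  "'a::real_inner set \<Rightarrow> 'b::real_inner set \<Rightarrow> ('a \<Rightarrow> 'b) \<Rightarrow> ('a \<Rightarrow> ereal) \<Rightarrow> ('b \<Rightarrow> ereal) \<Rightarrow>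
   (nat \<Rightarrow> real) \<Rightarrow> (nat \<Rightarrow> real) \<Rightarrow> (nat \<Rightarrow> real) \<Rightarrow> (nat \<Rightarrow> real) \<Rightarrow>
   (nat \<Rightarrow> 'a) \<Rightarrow> (nat \<Rightarrow> 'a) \<Rightarrow> (nat \<Rightarrow> 'b) \<Rightarrow> (nat \<Rightarrow> 'b) \<Rightarrow> bool" where
  "prox_scheme X Y K g h \<tau> \<sigma> \<alpha> \<beta> x xbar y ybar \<longleftrightarrow> (\<forall>k.
     y (Suc k) = Prox Y (\<lambda>v. ereal (\<sigma> k) * h v) (\<sigma> k *\<^sub>R K (xbar k) + y k) \<and>
     ybar (Suc k) = y (Suc k) + \<beta> k *\<^sub>R (y (Suc k) - y k) \<and>
     x (Suc k) = Prox X (\<lambda>u. ereal (\<tau> k) * g u) (- (\<tau> k *\<^sub>R adjoint K (ybar (Suc k))) + x k) \<and>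
     xbar (Suc k) = x (Suc k) + \<alpha> k *\<^sub>R (x (Suc k) - x k))"

end

theory Submission
  imports Defs
begin

text \<open>
  Why the two schemes agree: completing the square. With a step size \<open>c > 0\<close>, a linear term \<open>a\<close> and a
  current point \<open>z\<close>, the objective \<open>\<phi> u - \<langle>a, u\<rangle> + |u - z|^2 / (2 c)\<close> times \<open>c\<close> differs from the
  proximal objective \<open>c \<phi> u + |u - (c a + z)|^2 / 2\<close> only by a constant
  (\<open>linearized_step_eq_Prox\<close>). The dual step is the case \<open>a = K xbar\<close>, \<open>\<phi> = h\<close>; the primal step is
  the case \<open>a = - K\<^sup>* ybar\<close>, \<open>\<phi> = g\<close>, once \<open>\<langle>K u, ybar\<rangle>\<close> has been moved to \<open>\<langle>u, K\<^sup>* ybar\<rangle>\<close>. The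
  argmin and argmax operators choose from the set of optimal points, so two objectives that order
  the points of the feasible set in the same way yield the very same iterate. That the objectives
  are real valued on the feasible sets comes from the convex-concavity assumption: it forbids both infinite
  values of the coupling on \<open>X \<times> Y\<close>, hence \<open>g\<close> is finite on \<open>X\<close> and \<open>h\<close> on \<open>Y\<close>
  (\<open>finite_of_convex_concave_coupling\<close>).

  The inequalities are the first-order optimality condition of a proximal point
  (\<open>prox_minimizer_variational\<close>), divided by the step size. Here existence matters: the chosen
  iterate is known to be a minimizer only because there is one (\<open>prox_minimizer_exists\<close>). The
  proximal objective is bounded below, as a convex lower semicontinuous function decreases at
  most linearly; by the parallelogram identity a minimizing sequence is Cauchy; completeness gives
  a limit, and lower semicontinuity makes it a minimizer.

  The same two facts also supply the adjoint: the proximal point at \<open>0\<close> of \<open>- L\<close>, for a continuous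
  linear functional \<open>L\<close>, is the Riesz representative of \<open>L\<close>.
\<close>

section \<open>Lower semicontinuity of real-valued functions\<close>

lemma lsc_on_real_iff:
  "lsc_on C (\<lambda>u. ereal (\<phi> u)) \<longleftrightarrow>
    (\<forall>u\<in>C. \<forall>e>0. eventually (\<lambda>w. \<phi> u - e < \<phi> w) (at u within C))"
proof
  assume lsc: "lsc_on C (\<lambda>u. ereal (\<phi> u))"
  show "\<forall>u\<in>C. \<forall>e>0. eventually (\<lambda>w. \<phi> u - e < \<phi> w) (at u within C)"
  proof (intro ballI allI impI)
    fix u and e :: real assume "u \<in> C" "e > 0"
    moreover have "ereal (\<phi> u - e) < ereal (\<phi> u)" using \<open>e > 0\<close> by simp
    ultimately have "eventually (\<lambda>w. ereal (\<phi> u - e) < ereal (\<phi> w)) (at u within C)"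
      using lsc unfolding lsc_on_def le_Liminf_iff by blast
    then show "eventually (\<lambda>w. \<phi> u - e < \<phi> w) (at u within C)" by simp
  qed
next
  assume ev: "\<forall>u\<in>C. \<forall>e>0. eventually (\<lambda>w. \<phi> u - e < \<phi> w) (at u within C)"
  show "lsc_on C (\<lambda>u. ereal (\<phi> u))"
    unfolding lsc_on_def le_Liminf_iff
  proof (intro ballI allI impI)
    fix u y assume u: "u \<in> C" and y: "y < ereal (\<phi> u)"
    then obtain r where r: "y < ereal r" "r < \<phi> u"
      using ereal_dense2[OF y] by auto
    have "eventually (\<lambda>w. \<phi> u - (\<phi> u - r) < \<phi> w) (at u within C)"
      using ev u r(2) by (meson diff_gt_0_iff_gt)
    then show "eventually (\<lambda>w. y < ereal (\<phi> w)) (at u within C)"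
    proof eventually_elim
      case (elim w)
      then have "ereal r < ereal (\<phi> w)" by simp
      with r(1) show ?case by (rule less_trans)
    qed
  qed
qed

lemma lsc_on_cmult_real:
  assumes "lsc_on C (\<lambda>u. ereal (\<phi> u))" "c > 0"
  shows "lsc_on C (\<lambda>u. ereal (c * \<phi> u))"
  unfolding lsc_on_real_iff
proof (intro ballI allI impI)
  fix u and e :: real assume "u \<in> C" "e > 0"
  then have "eventually (\<lambda>w. \<phi> u - e / c < \<phi> w) (at u within C)"
    using assms by (simp add: lsc_on_real_iff)
  then show "eventually (\<lambda>w. c * \<phi> u - e < c * \<phi> w) (at u within C)"
    by eventually_elim (use \<open>c > 0\<close> in \<open>simp add: field_simps\<close>)
qed

lemma lsc_on_realD:
  fixes \<phi> :: "'a::metric_space \<Rightarrow> real"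
  assumes "lsc_on C (\<lambda>u. ereal (\<phi> u))" "u \<in> C" "e > 0"
  obtains d where "d > 0" "\<And>w. w \<in> C \<Longrightarrow> dist w u < d \<Longrightarrow> \<phi> u - e < \<phi> w"
proof -
  have "eventually (\<lambda>w. \<phi> u - e < \<phi> w) (at u within C)"
    using assms by (simp add: lsc_on_real_iff)
  then obtain d where d: "d > 0" "\<And>w. w \<in> C \<Longrightarrow> w \<noteq> u \<Longrightarrow> dist w u < d \<Longrightarrow> \<phi> u - e < \<phi> w"
    unfolding eventually_at by auto
  have "\<phi> u - e < \<phi> w" if "w \<in> C" "dist w u < d" for w
    using d(2)[OF that(1) _ that(2)] \<open>e > 0\<close> by (cases "w = u") auto
  then show thesis using d(1) that by blast
qed

text \<open>
  Passage to real values: the Hilbert space arguments below are about real-valued functions on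
  \<open>C\<close>, where no rule for infinite sums intervenes.
\<close>
lemma proper_convex_lsc_real:
  fixes \<phi> :: "'a::real_normed_vector \<Rightarrow> ereal"
  assumes "proper_convex_lsc_on UNIV \<phi>" "convex C" and fin: "\<forall>u\<in>C. \<bar>\<phi> u\<bar> \<noteq> \<infinity>"
  shows "convex_on C (\<lambda>u. real_of_ereal (\<phi> u))"
    and "lsc_on C (\<lambda>u. ereal (real_of_ereal (\<phi> u)))"
proof -
  have re: "ereal (real_of_ereal (\<phi> u)) = \<phi> u" if "u \<in> C" for u
    using fin that by (simp add: ereal_real)
  show "convex_on C (\<lambda>u. real_of_ereal (\<phi> u))"
  proof (rule convex_onI[OF _ \<open>convex C\<close>])
    fix t :: real and u v assume t: "0 < t" "t < 1" and uv: "u \<in> C" "v \<in> C"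
    have "(1 - t) *\<^sub>R u + t *\<^sub>R v \<in> C" using convexD_alt[OF \<open>convex C\<close> uv, of t] t by simp
    with uv obtain a b q where "\<phi> u = ereal a" "\<phi> v = ereal b"
        "\<phi> ((1 - t) *\<^sub>R u + t *\<^sub>R v) = ereal q"
      using re by metis
    moreover have "\<phi> ((1 - t) *\<^sub>R u + t *\<^sub>R v) \<le> ereal (1 - t) * \<phi> u + ereal t * \<phi> v"
      using assms(1) t by (simp add: proper_convex_lsc_on_def ereal_convex_on_def)
    ultimately show "real_of_ereal (\<phi> ((1 - t) *\<^sub>R u + t *\<^sub>R v))
        \<le> (1 - t) * real_of_ereal (\<phi> u) + t * real_of_ereal (\<phi> v)"
      by simp
  qed
  show "lsc_on C (\<lambda>u. ereal (real_of_ereal (\<phi> u)))"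
    unfolding lsc_on_def le_Liminf_iff
  proof (intro ballI allI impI)
    fix u y assume u: "u \<in> C" and y: "y < ereal (real_of_ereal (\<phi> u))"
    have "eventually (\<lambda>w. y < \<phi> w) (at u)"
      using assms(1) y re[OF u] by (auto simp: proper_convex_lsc_on_def lsc_on_def le_Liminf_iff)
    then have "eventually (\<lambda>w. y < \<phi> w) (at u within C)"
      by (rule filter_leD[OF at_le, rotated]) simp
    moreover have "eventually (\<lambda>w. w \<in> C) (at u within C)"
      by (simp add: eventually_at_filter)
    ultimately show "eventually (\<lambda>w. y < ereal (real_of_ereal (\<phi> w))) (at u within C)"
      by eventually_elim (use re in auto)
  qed
qed

section \<open>Minimizers of proximal objectives\<close>

text \<open>
  Lower semicontinuity keeps \<open>\<phi>\<close> above \<open>\<phi> z - 1\<close> on a small ball around \<open>z\<close>. If \<open>\<phi>\<close> fell faster than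
  linearly along a ray from \<open>z\<close>, convexity would pull it below that level inside the ball. This
  replaces the affine minorant that a separation theorem would provide.
\<close>
lemma convex_lsc_linear_lower_bound:
  fixes \<phi> :: "'a::real_normed_vector \<Rightarrow> real"
  assumes cv: "convex_on C \<phi>" and lsc: "lsc_on C (\<lambda>u. ereal (\<phi> u))" and z: "z \<in> C"
  obtains a where "a > 0" "\<And>u. u \<in> C \<Longrightarrow> \<phi> z - 1 - a * norm (u - z) \<le> \<phi> u"
proof -
  obtain d where d: "d > 0" "\<And>w. w \<in> C \<Longrightarrow> dist w z < d \<Longrightarrow> \<phi> z - 1 < \<phi> w"
    using lsc_on_realD[OF lsc z zero_less_one] by blast
  have "\<phi> z - 1 - (2 / d) * norm (u - z) \<le> \<phi> u" if u: "u \<in> C" for u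
  proof (cases "norm (u - z) < d")
    case True
    then have "\<phi> z - 1 < \<phi> u" using d(2)[OF u] by (simp add: dist_norm)
    moreover have "0 \<le> (2 / d) * norm (u - z)" using d(1) by simp
    ultimately show ?thesis by linarith
  next
    case False
    define r where "r = norm (u - z)"
    \<comment> \<open>This weight puts the point \<open>w\<close> of the segment at distance \<open>d / 2\<close> from \<open>z\<close>, so inside the ball.\<close>
    define t where "t = d / (2 * r)"
    have r: "r \<ge> d" "r > 0" using False d(1) by (auto simp: r_def)
    have t: "0 < t" "t < 1" using r d(1) by (auto simp: t_def divide_simps)
    define w where "w = (1 - t) *\<^sub>R z + t *\<^sub>R u"
    have "w - z = t *\<^sub>R (u - z)" by (simp add: w_def algebra_simps)
    then have "dist w z = t * r" using t by (simp add: dist_norm r_def)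
    also have "\<dots> = d / 2" using r by (simp add: t_def)
    finally have "dist w z < d" using d(1) by simp
    moreover have "w \<in> C"
      using convexD_alt[OF convex_on_imp_convex[OF cv] z u] t by (simp add: w_def)
    ultimately have "\<phi> z - 1 < \<phi> w" using d(2) by blast
    also have "\<phi> w \<le> (1 - t) * \<phi> z + t * \<phi> u"
      using convex_onD[OF cv _ _ z u, of t] t by (simp add: w_def)
    finally have "t * (\<phi> z - \<phi> u) \<le> 1" by (simp add: algebra_simps)
    then have "\<phi> z - \<phi> u \<le> 1 / t" using t by (simp add: field_simps)
    also have "1 / t = (2 / d) * r" by (simp add: t_def)
    finally show ?thesis by (simp add: r_def)
  qed
  then show thesis using that[of "2 / d"] d(1) by simp
qed

text \<open>
  Strong convexity in quantitative form, by comparison with the midpoint: two points whose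
  objective values are nearly minimal are close to each other.
\<close>
lemma prox_objective_midpoint:
  fixes \<phi> :: "'a::real_inner \<Rightarrow> real"
  assumes cv: "convex_on C \<phi>" and u: "u \<in> C" and w: "w \<in> C"
    and m: "\<And>q. q \<in> C \<Longrightarrow> m \<le> \<phi> q + 1/2 * (norm (q - v))\<^sup>2"
  shows "(norm (u - w))\<^sup>2
    \<le> 4 * ((\<phi> u + 1/2 * (norm (u - v))\<^sup>2 - m) + (\<phi> w + 1/2 * (norm (w - v))\<^sup>2 - m))"
proof -
  define q where "q = (1 - 1/2) *\<^sub>R u + (1/2::real) *\<^sub>R w"
  have "q \<in> C"
    using convexD_alt[OF convex_on_imp_convex[OF cv] u w, of "1/2"] by (simp add: q_def)
  then have "m \<le> \<phi> q + 1/2 * (norm (q - v))\<^sup>2" by (rule m)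
  moreover have "\<phi> q \<le> (1 - 1/2) * \<phi> u + 1/2 * \<phi> w"
    unfolding q_def by (rule convex_onD[OF cv _ _ u w]) auto
  moreover have "(norm (q - v))\<^sup>2
      = 1/2 * (norm (u - v))\<^sup>2 + 1/2 * (norm (w - v))\<^sup>2 - 1/4 * (norm (u - w))\<^sup>2"
    by (simp add: q_def power2_norm_eq_inner algebra_simps inner_commute)
  ultimately show ?thesis by (simp add: field_simps)
qed

text \<open>
  Existence without compactness: strong convexity makes minimizing sequences Cauchy.
\<close>
lemma prox_minimizer_exists:
  fixes \<phi> :: "'a::{real_inner, complete_space} \<Rightarrow> real"
  assumes "closed C" "C \<noteq> {}" and cv: "convex_on C \<phi>" and lsc: "lsc_on C (\<lambda>u. ereal (\<phi> u))"
  obtains p where "p \<in> C"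
    "\<And>u. u \<in> C \<Longrightarrow> \<phi> p + 1/2 * (norm (p - v))\<^sup>2 \<le> \<phi> u + 1/2 * (norm (u - v))\<^sup>2"
proof -
  define F where "F = (\<lambda>u. \<phi> u + 1/2 * (norm (u - v))\<^sup>2)"
  obtain z where z: "z \<in> C" using \<open>C \<noteq> {}\<close> by blast
  obtain a where a: "a > 0" "\<And>u. u \<in> C \<Longrightarrow> \<phi> z - 1 - a * norm (u - z) \<le> \<phi> u"
    using convex_lsc_linear_lower_bound[OF cv lsc z] by blast
  have bound: "\<phi> z - 1 - a * norm (v - z) - a\<^sup>2 / 2 \<le> F u" if u: "u \<in> C" for u
  proof -
    have "norm (u - z) \<le> norm (u - v) + norm (v - z)"
      using norm_triangle_ineq[of "u - v" "v - z"] by simp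
    then have "a * norm (u - z) \<le> a * norm (u - v) + a * norm (v - z)"
      using a(1) by (metis distrib_left mult_le_cancel_left_pos)
    \<comment> \<open>Young's inequality: the quadratic term absorbs the linear decrease of \<open>\<phi>\<close>.\<close>
    moreover have "0 \<le> (norm (u - v) - a)\<^sup>2" by simp
    ultimately show ?thesis
      using a(2)[OF u] by (simp add: F_def power2_diff field_simps)
  qed
  then have bdd: "bdd_below (F ` C)" by (meson bdd_belowI2)
  define m where "m = Inf (F ` C)"
  have m: "m \<le> F u" if "u \<in> C" for u
    unfolding m_def using that bdd by (intro cInf_lower) auto
  have "\<exists>u\<in>C. F u < m + inverse (real (Suc n))" for n
  proof -
    have "Inf (F ` C) < m + inverse (real (Suc n))" by (simp add: m_def)
    then show ?thesis using cInf_lessD[of "F ` C"] \<open>C \<noteq> {}\<close> by blast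
  qed
  then obtain w where w: "\<And>n. w n \<in> C" "\<And>n. F (w n) < m + inverse (real (Suc n))" by metis
  have gap: "(norm (w i - w j))\<^sup>2 \<le> 4 * (inverse (real (Suc i)) + inverse (real (Suc j)))" for i j
  proof -
    have "(norm (w i - w j))\<^sup>2 \<le> 4 * ((F (w i) - m) + (F (w j) - m))"
      unfolding F_def
      by (rule prox_objective_midpoint[OF cv w(1) w(1)]) (use m in \<open>simp add: F_def\<close>)
    then show ?thesis using w(2)[of i] w(2)[of j] by simp
  qed
  have "Cauchy w"
  proof (rule metric_CauchyI)
    fix e :: real assume e: "e > 0"
    then obtain N :: nat where N: "8 / e\<^sup>2 < real N" using reals_Archimedean2 by blast
    have "dist (w i) (w j) < e" if ij: "N \<le> i" "N \<le> j" for i j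
    proof -
      have small: "inverse (real (Suc n)) < e\<^sup>2 / 8" if "N \<le> n" for n
      proof -
        have "8 / e\<^sup>2 < real (Suc n)" using N that by linarith
        then show ?thesis using e by (simp add: field_simps)
      qed
      have "(norm (w i - w j))\<^sup>2 < e\<^sup>2"
        using gap[of i j] small[OF ij(1)] small[OF ij(2)] by simp
      then show ?thesis using e by (simp add: dist_norm power2_less_imp_less)
    qed
    then show "\<exists>N. \<forall>i\<ge>N. \<forall>j\<ge>N. dist (w i) (w j) < e" by blast
  qed
  then obtain p where p: "w \<longlonglongrightarrow> p" using Cauchy_convergent convergent_def by blast
  have pC: "p \<in> C" using closed_sequentially[OF \<open>closed C\<close>] w(1) p by blast
  have "F p \<le> m"
  proof (rule field_le_epsilon)
    fix e :: real assume e: "e > 0"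
    obtain d where d: "d > 0" "\<And>u. u \<in> C \<Longrightarrow> dist u p < d \<Longrightarrow> \<phi> p - e < \<phi> u"
      using lsc_on_realD[OF lsc pC e] by blast
    have ev: "eventually (\<lambda>n. \<phi> p - e + 1/2 * (norm (w n - v))\<^sup>2 \<le> m + inverse (real (Suc n))) sequentially"
      using tendstoD[OF p d(1)]
    proof eventually_elim
      case (elim n)
      then show ?case using d(2)[OF w(1), of n] w(2)[of n] by (simp add: F_def)
    qed
    have "(\<lambda>n. \<phi> p - e + 1/2 * (norm (w n - v))\<^sup>2) \<longlonglongrightarrow> \<phi> p - e + 1/2 * (norm (p - v))\<^sup>2"
      by (intro tendsto_intros p)
    with LIMSEQ_inverse_real_of_nat_add[of m] have "\<phi> p - e + 1/2 * (norm (p - v))\<^sup>2 \<le> m"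
      using ev by (intro tendsto_le[OF sequentially_bot])
    then show "F p \<le> m + e" by (simp add: F_def)
  qed
  then have "F p \<le> F u" if "u \<in> C" for u using m[OF that] by linarith
  then show thesis using that[of p] pC by (simp add: F_def)
qed

text \<open>
  Moving from the minimizer \<open>p\<close> a fraction \<open>t\<close> towards \<open>u\<close> changes the objective by at most
  \<open>t (A + t B)\<close>, where \<open>t\<^sup>2 B\<close> is the quadratic part of the expanded square; so \<open>A + t B\<close> is nonnegative for all
  small \<open>t\<close>, and \<open>A\<close>, which carries the claim, is its limit at \<open>0\<close>.
\<close>
lemma prox_minimizer_variational:
  fixes \<phi> :: "'a::real_inner \<Rightarrow> real"
  assumes cv: "convex_on C \<phi>" and p: "p \<in> C" and u: "u \<in> C"
    and min: "\<And>w. w \<in> C \<Longrightarrow> \<phi> p + 1/2 * (norm (p - v))\<^sup>2 \<le> \<phi> w + 1/2 * (norm (w - v))\<^sup>2"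
  shows "(v - p) \<bullet> (u - p) + \<phi> p \<le> \<phi> u"
proof -
  define A where "A = \<phi> u - \<phi> p - (v - p) \<bullet> (u - p)"
  define B where "B = 1/2 * (norm (u - p))\<^sup>2"
  have AB: "0 \<le> A + t * B" if t: "0 < t" "t \<le> 1" for t
  proof -
    define w where "w = (1 - t) *\<^sub>R p + t *\<^sub>R u"
    have wC: "w \<in> C"
      using convexD_alt[OF convex_on_imp_convex[OF cv] p u, of t] t by (simp add: w_def)
    have cw: "\<phi> w \<le> (1 - t) * \<phi> p + t * \<phi> u"
      unfolding w_def by (rule convex_onD[OF cv _ _ p u]) (use t in auto)
    have wv: "w - v = (p - v) + t *\<^sub>R (u - p)" by (simp add: w_def algebra_simps)
    have square: "(norm (r + t *\<^sub>R s))\<^sup>2 = (norm r)\<^sup>2 + 2 * (t * (r \<bullet> s)) + t * (t * (norm s)\<^sup>2)"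
      for r s :: 'a
      unfolding power2_norm_eq_inner by (simp add: algebra_simps inner_commute)
    have flip: "(p - v) \<bullet> (u - p) = - ((v - p) \<bullet> (u - p))" by (simp add: inner_diff_left)
    have "1/2 * (norm (w - v))\<^sup>2
        = 1/2 * (norm (p - v))\<^sup>2 - t * ((v - p) \<bullet> (u - p)) + t * (t * B)"
      unfolding wv square flip B_def by (simp add: distrib_left)
    then have "0 \<le> t * (A + t * B)"
      using min[OF wC] cw unfolding A_def by (simp add: algebra_simps del: inner_diff_left inner_diff_right)
    then show ?thesis using t by (simp add: zero_le_mult_iff)
  qed
  have "0 \<le> A"
  proof (rule tendsto_lowerbound)
    show "((\<lambda>t. A + t * B) \<longlongrightarrow> A) (at_right 0)" by (auto intro!: tendsto_eq_intros)
    show "eventually (\<lambda>t. 0 \<le> A + t * B) (at_right 0)"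
      using AB by (auto intro!: eventually_at_rightI[of 0 1])
  qed simp
  then show ?thesis by (simp add: A_def)
qed

section \<open>The adjoint of a continuous linear operator\<close>

text \<open>
  The minimizer \<open>p\<close> of \<open>|u|^2 / 2 - L u\<close> represents \<open>L\<close>: its variational inequality reads
  \<open>L w \<le> \<langle>w, p\<rangle>\<close> for every direction \<open>w\<close>, and replacing \<open>w\<close> by \<open>- w\<close> turns it into an equality.
\<close>
lemma riesz_representation:
  fixes L :: "'a::{real_inner, complete_space} \<Rightarrow> real"
  assumes "bounded_linear L"
  obtains p where "\<And>w. L w = w \<bullet> p"
proof -
  interpret L: bounded_linear L by fact
  have cv: "convex_on UNIV (\<lambda>u. - L u)"
    by (rule convex_onI) (auto simp: L.add L.scale)
  have "eventually (\<lambda>w. - L u - e < - L w) (at u)" if "e > 0" for u e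
  proof -
    have "((\<lambda>w. - L w) \<longlongrightarrow> - L u) (at u)"
      by (intro tendsto_minus L.tendsto tendsto_ident_at)
    then show ?thesis using that by (auto elim: order_tendstoD)
  qed
  then have lsc: "lsc_on UNIV (\<lambda>u. ereal (- L u))"
    by (simp add: lsc_on_real_iff)
  obtain p where p: "\<And>u. - L p + 1/2 * (norm (p - 0))\<^sup>2 \<le> - L u + 1/2 * (norm (u - 0))\<^sup>2"
    using prox_minimizer_exists[OF closed_UNIV _ cv lsc, where v = 0] by auto
  have le: "L w \<le> w \<bullet> p" for w
    using prox_minimizer_variational[OF cv, of p "p + w" 0] p
    by (simp add: L.add inner_commute)
  have "L w = w \<bullet> p" for w
    using le[of w] le[of "- w"] by (simp add: linear_neg[OF L.linear])
  then show thesis by (rule that)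
qed

text \<open>
  The constant \<open>adjoint\<close> is a choice of a function with this property, so the task is to show that
  such a function exists; pointwise in \<open>v\<close> it is the Riesz representative of \<open>\<lambda>u. \<langle>K u, v\<rangle>\<close>.
\<close>
lemma adjoint_bounded_linear:
  fixes K :: "'a::{real_inner, complete_space} \<Rightarrow> 'b::real_inner"
  assumes "bounded_linear K"
  shows "K u \<bullet> v = u \<bullet> adjoint K v"
proof -
  have "\<exists>p. \<forall>u. K u \<bullet> v = u \<bullet> p" for v
    using riesz_representation[OF bounded_linear_compose[OF bounded_linear_inner_left assms]] by metis
  then obtain K' where K': "\<forall>u v. K u \<bullet> v = u \<bullet> K' v" by metis
  then show ?thesis using adjoint_unique[OF K'] by simp
qed

section \<open>Subproblems as proximal steps\<close>

text \<open>
  The next two lemmas transfer the choice of an optimal point between objectives that order \<open>S\<close>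
  in the same or the opposite way. The sets of optimal points coincide, so the choice made from
  them does too.
\<close>
lemma arg_min_on_eq_affine:
  fixes f :: "'a \<Rightarrow> ereal" and q :: "'a \<Rightarrow> real"
  assumes "c > 0" and f: "\<And>u. u \<in> S \<Longrightarrow> f u = ereal (c * q u + d)"
  shows "arg_min_on f S = arg_min_on q S"
proof -
  have "is_arg_min f (\<lambda>u. u \<in> S) = is_arg_min q (\<lambda>u. u \<in> S)"
    using assms by (auto simp: is_arg_min_def fun_eq_iff)
  then show ?thesis
    by (simp add: arg_min_on_def arg_min_def)
qed

lemma arg_max_on_eq_reflected:
  fixes f :: "'a \<Rightarrow> ereal" and q :: "'a \<Rightarrow> real"
  assumes f: "\<And>u. u \<in> S \<Longrightarrow> f u = ereal (d - q u)"
  shows "arg_max_on f S = arg_min_on q S"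
proof -
  have "is_arg_max f (\<lambda>u. u \<in> S) = is_arg_min q (\<lambda>u. u \<in> S)"
    using assms by (auto simp: is_arg_min_def is_arg_max_def fun_eq_iff)
  then show ?thesis
    by (simp add: arg_min_on_def arg_min_def arg_max_on_def arg_max_def)
qed

text \<open>
  Completing the square: expanding \<open>|(u - z) - c a|^2 / 2\<close> produces \<open>|u - z|^2 / 2\<close>, the linear term
  \<open>- c \<langle>a, u\<rangle>\<close> and terms that do not depend on \<open>u\<close>.
\<close>
lemma linearized_step_eq_Prox:
  fixes \<phi> :: "'a::real_inner \<Rightarrow> ereal"
  assumes fin: "\<forall>u\<in>C. \<bar>\<phi> u\<bar> \<noteq> \<infinity>" and "c > 0"
  shows "Prox C (\<lambda>u. ereal c * \<phi> u) (c *\<^sub>R a + z)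
    = arg_min_on (\<lambda>u. real_of_ereal (\<phi> u) - a \<bullet> u + 1 / (2 * c) * (norm (u - z))\<^sup>2) C"
  unfolding Prox_def
proof (rule arg_min_on_eq_affine[OF \<open>c > 0\<close>])
  fix u assume u: "u \<in> C"
  obtain r where r: "\<phi> u = ereal r" using fin u by (cases "\<phi> u") auto
  have "u - (c *\<^sub>R a + z) = (u - z) - c *\<^sub>R a" by simp
  then have "1/2 * (norm (u - (c *\<^sub>R a + z)))\<^sup>2
      = 1/2 * (norm (u - z))\<^sup>2 - c * (a \<bullet> u) + (c * (a \<bullet> z) + c\<^sup>2 / 2 * (a \<bullet> a))"
    unfolding power2_norm_eq_inner
    by (simp add: algebra_simps inner_commute power2_eq_square)
  then show "ereal c * \<phi> u + ereal (1/2 * (norm (u - (c *\<^sub>R a + z)))\<^sup>2)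
      = ereal (c * (real_of_ereal (\<phi> u) - a \<bullet> u + 1 / (2 * c) * (norm (u - z))\<^sup>2)
          + (c * (a \<bullet> z) + c\<^sup>2 / 2 * (a \<bullet> a)))"
    using \<open>c > 0\<close> r by (simp add: algebra_simps)
qed

text \<open>
  The variational inequality of the proximal point of \<open>c \<phi>\<close> at \<open>c a + z\<close>, divided by \<open>c\<close>.
\<close>
lemma Prox_step_inequality:
  fixes \<phi> :: "'a::{real_inner, complete_space} \<Rightarrow> ereal"
  assumes \<phi>: "proper_convex_lsc_on UNIV \<phi>"
    and C: "closed C" "convex C" "C \<noteq> {}"
    and fin: "\<forall>u\<in>C. \<bar>\<phi> u\<bar> \<noteq> \<infinity>" and c: "c > 0" and u: "u \<in> C"
    and p: "p = Prox C (\<lambda>u. ereal c * \<phi> u) (c *\<^sub>R a + z)"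
  shows "ereal (((z - p) /\<^sub>R c + a) \<bullet> (u - p)) + \<phi> p \<le> \<phi> u"
proof -
  define r where "r = (\<lambda>u. real_of_ereal (\<phi> u))"
  define v where "v = c *\<^sub>R a + z"
  have real: "convex_on C r" "lsc_on C (\<lambda>u. ereal (r u))"
    unfolding r_def by (rule proper_convex_lsc_real[OF \<phi> C(2) fin])+
  have re: "\<phi> u = ereal (r u)" if "u \<in> C" for u
    using fin that by (simp add: ereal_real r_def)
  have cv: "convex_on C (\<lambda>u. c * r u)" using real(1) c by (simp add: convex_on_cmul)
  have lsc: "lsc_on C (\<lambda>u. ereal (c * r u))"
    by (rule lsc_on_cmult_real[OF real(2) c])
  define F where "F = (\<lambda>u. c * r u + 1/2 * (norm (u - v))\<^sup>2)"
  obtain q where q: "q \<in> C" "\<And>u. u \<in> C \<Longrightarrow> F q \<le> F u"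
    using prox_minimizer_exists[OF C(1,3) cv lsc, where v = v] unfolding F_def by blast
  have "p = arg_min_on F C"
    unfolding p Prox_def v_def[symmetric]
    by (rule arg_min_on_eq_affine[where c = 1 and d = 0]) (auto simp: F_def re)
  moreover have "is_arg_min F (\<lambda>u. u \<in> C) q" using q by (auto simp: is_arg_min_linorder)
  \<comment> \<open>The chosen point \<open>p\<close> is a minimizer because the minimizer \<open>q\<close> exists.\<close>
  ultimately have "is_arg_min F (\<lambda>u. u \<in> C) p"
    unfolding arg_min_on_def arg_min_def by (metis someI)
  then have pm: "p \<in> C" "\<And>u. u \<in> C \<Longrightarrow> F p \<le> F u" by (auto simp: is_arg_min_linorder)
  have "(v - p) \<bullet> (u - p) + c * r p \<le> c * r u"
    using prox_minimizer_variational[OF cv pm(1) u, of v] pm(2) by (simp add: F_def)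
  moreover have "v - p = c *\<^sub>R ((z - p) /\<^sub>R c + a)"
    using c by (simp add: v_def algebra_simps)
  ultimately have "c * (((z - p) /\<^sub>R c + a) \<bullet> (u - p) + r p) \<le> c * r u"
    by (simp add: distrib_left)
  then have "((z - p) /\<^sub>R c + a) \<bullet> (u - p) + r p \<le> r u" using c by simp
  then show ?thesis using re pm(1) u by simp
qed

section \<open>The convex-concave coupling and the two schemes\<close>

text \<open>
  Properness of \<open>f(\<cdot>, v)\<close> excludes the value \<open>- \<infinity>\<close> on \<open>X \<times> Y\<close> and properness of \<open>- f(u, \<cdot>)\<close> excludes
  \<open>\<infinity>\<close>, whereas an infinite value of \<open>g u\<close> or \<open>h v\<close> would make \<open>f(u, v)\<close> infinite.
\<close>
lemma finite_of_convex_concave_coupling: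
  fixes X :: "'a::real_inner set" and Y :: "'b::real_inner set"
  assumes "X \<noteq> {}" "Y \<noteq> {}" and cc: "convex_concave_on X Y (coupling X Y K g h)"
    and gp: "\<And>u. g u \<noteq> -\<infinity>" and hp: "\<And>v. h v \<noteq> -\<infinity>"
  shows "\<forall>u\<in>X. \<bar>g u\<bar> \<noteq> \<infinity>" and "\<forall>v\<in>Y. \<bar>h v\<bar> \<noteq> \<infinity>"
proof -
  have *: "\<bar>g u\<bar> \<noteq> \<infinity> \<and> \<bar>h v\<bar> \<noteq> \<infinity>" if u: "u \<in> X" and v: "v \<in> Y" for u v
  proof -
    have "coupling X Y K g h u v \<noteq> -\<infinity>" "- coupling X Y K g h u v \<noteq> -\<infinity>"
      using cc u v
      unfolding convex_concave_on_def proper_convex_lsc_on_def proper_on_def by blast+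
    then show ?thesis
      using gp[of u] hp[of v] coupling_on[OF u v, of K g h]
      by (cases "g u"; cases "h v") auto
  qed
  obtain u0 v0 where "u0 \<in> X" "v0 \<in> Y" using assms(1,2) by auto
  then show "\<forall>u\<in>X. \<bar>g u\<bar> \<noteq> \<infinity>" "\<forall>v\<in>Y. \<bar>h v\<bar> \<noteq> \<infinity>"
    using *[of _ v0] *[of u0] by simp_all
qed

theorem lemma4p1:
  fixes X :: "'a::{real_inner, complete_space} set"
    and Y :: "'b::{real_inner, complete_space} set"
    and K :: "'a \<Rightarrow> 'b"
    and g :: "'a \<Rightarrow> ereal" and h :: "'b \<Rightarrow> ereal"
    and \<tau> \<sigma> \<alpha> \<beta> :: "nat \<Rightarrow> real"
    and x xbar :: "nat \<Rightarrow> 'a" and y ybar :: "nat \<Rightarrow> 'b"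
  assumes "X \<noteq> {}" "closed X" "convex X"
    and "Y \<noteq> {}" "closed Y" "convex Y"
    and "bounded_linear K"
    and "proper_convex_lsc_on UNIV g" "proper_convex_lsc_on UNIV h"
    and "convex_concave_on X Y (coupling X Y K g h)"
    and "\<And>k. \<tau> k > 0" "\<And>k. \<sigma> k > 0" "\<And>k. \<alpha> k \<ge> 0" "\<And>k. \<beta> k \<ge> 0"
    and "x 0 \<in> X" "y 0 \<in> Y" "xbar 0 = x 0" "ybar 0 = y 0"
  shows "(minimax_scheme X Y (coupling X Y K g h) \<tau> \<sigma> \<alpha> \<beta> x xbar y ybar \<longleftrightarrow>
            prox_scheme X Y K g h \<tau> \<sigma> \<alpha> \<beta> x xbar y ybar) \<and>
         (minimax_scheme X Y (coupling X Y K g h) \<tau> \<sigma> \<alpha> \<beta> x xbar y ybar \<longrightarrow>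
            (\<forall>k.
              (\<forall>u\<in>X. ereal (((x k - x (Suc k)) /\<^sub>R \<tau> k - adjoint K (ybar (Suc k))) \<bullet> (u - x (Suc k)))
                        + g (x (Suc k)) \<le> g u) \<and>
              (\<forall>v\<in>Y. ereal (((y k - y (Suc k)) /\<^sub>R \<sigma> k + K (xbar k)) \<bullet> (v - y (Suc k)))
                        + h (y (Suc k)) \<le> h v)))"
proof -
  have "\<And>u. g u \<noteq> -\<infinity>" "\<And>v. h v \<noteq> -\<infinity>"
    using assms(8,9) by (auto simp: proper_convex_lsc_on_def proper_on_def)
  note fin = finite_of_convex_concave_coupling[OF assms(1,4,10) this]
  have off: "\<exists>r. finite_off X g u = ereal r" "\<exists>r. finite_off Y h v = ereal r" for u v
    using fin by (cases "g u"; cases "h v"; auto simp: finite_off_def)+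
  \<comment> \<open>The step at an arbitrary \<open>\<xi>\<close>, since an extrapolated point may leave \<open>X\<close>; there \<open>finite_off\<close>
    still contributes a real constant \<open>d\<close> to the objective, which does not affect the maximizers.
    The primal step is treated in the same way.\<close>
  have y_step: "arg_max_on (\<lambda>v. coupling X Y K g h \<xi> v - ereal (1 / (2 * s) * (norm (v - z))\<^sup>2)) Y
      = Prox Y (\<lambda>v. ereal s * h v) (s *\<^sub>R K \<xi> + z)" if s: "s > 0" for \<xi> s z
  proof -
    obtain d where d: "finite_off X g \<xi> = ereal d" using off(1) by blast
    show ?thesis
      unfolding linearized_step_eq_Prox[OF fin(2) s]
    proof (rule arg_max_on_eq_reflected)
      fix v assume v: "v \<in> Y"
      obtain r where "h v = ereal r" using fin(2) v by (cases "h v") auto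
      then show "coupling X Y K g h \<xi> v - ereal (1 / (2 * s) * (norm (v - z))\<^sup>2)
          = ereal (d - (real_of_ereal (h v) - K \<xi> \<bullet> v + 1 / (2 * s) * (norm (v - z))\<^sup>2))"
        using v d by (simp add: coupling_def finite_off_def)
    qed
  qed
  have x_step: "arg_min_on (\<lambda>u. coupling X Y K g h u \<eta> + ereal (1 / (2 * s) * (norm (u - z))\<^sup>2)) X
      = Prox X (\<lambda>u. ereal s * g u) (- (s *\<^sub>R adjoint K \<eta>) + z)" if s: "s > 0" for \<eta> s z
  proof -
    obtain d where d: "finite_off Y h \<eta> = ereal d" using off(2) by blast
    show ?thesis
      unfolding linearized_step_eq_Prox[OF fin(1) s, where a = "- adjoint K \<eta>", unfolded scaleR_minus_right]
    proof (rule arg_min_on_eq_affine[OF zero_less_one])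
      fix u assume u: "u \<in> X"
      have "K u \<bullet> \<eta> = adjoint K \<eta> \<bullet> u"
        by (metis adjoint_bounded_linear[OF assms(7)] inner_commute)
      moreover obtain r where "g u = ereal r" using fin(1) u by (cases "g u") auto
      ultimately show "coupling X Y K g h u \<eta> + ereal (1 / (2 * s) * (norm (u - z))\<^sup>2)
          = ereal (1 * (real_of_ereal (g u) - (- adjoint K \<eta>) \<bullet> u
              + 1 / (2 * s) * (norm (u - z))\<^sup>2) + (- d))"
        using u d
        by (simp add: coupling_def finite_off_def)
    qed
  qed
  have equiv: "minimax_scheme X Y (coupling X Y K g h) \<tau> \<sigma> \<alpha> \<beta> x xbar y ybar \<longleftrightarrow>
      prox_scheme X Y K g h \<tau> \<sigma> \<alpha> \<beta> x xbar y ybar"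
    unfolding minimax_scheme_def prox_scheme_def
    by (simp only: y_step[OF assms(12)] x_step[OF assms(11)])
  moreover have "(\<forall>u\<in>X. ereal (((x k - x (Suc k)) /\<^sub>R \<tau> k - adjoint K (ybar (Suc k))) \<bullet> (u - x (Suc k)))
                   + g (x (Suc k)) \<le> g u) \<and>
      (\<forall>v\<in>Y. ereal (((y k - y (Suc k)) /\<^sub>R \<sigma> k + K (xbar k)) \<bullet> (v - y (Suc k)))
                   + h (y (Suc k)) \<le> h v)"
    if "prox_scheme X Y K g h \<tau> \<sigma> \<alpha> \<beta> x xbar y ybar" for k
  proof (intro conjI ballI)
    have px: "x (Suc k) = Prox X (\<lambda>u. ereal (\<tau> k) * g u) (\<tau> k *\<^sub>R (- adjoint K (ybar (Suc k))) + x k)"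
      and py: "y (Suc k) = Prox Y (\<lambda>v. ereal (\<sigma> k) * h v) (\<sigma> k *\<^sub>R K (xbar k) + y k)"
      using that by (auto simp: prox_scheme_def)
    show "ereal (((x k - x (Suc k)) /\<^sub>R \<tau> k - adjoint K (ybar (Suc k))) \<bullet> (u - x (Suc k)))
        + g (x (Suc k)) \<le> g u" if "u \<in> X" for u
      using Prox_step_inequality[OF assms(8,2,3,1) fin(1) assms(11) that px] by simp
    show "ereal (((y k - y (Suc k)) /\<^sub>R \<sigma> k + K (xbar k)) \<bullet> (v - y (Suc k)))
        + h (y (Suc k)) \<le> h v" if "v \<in> Y" for v
      using Prox_step_inequality[OF assms(9,5,6,4) fin(2) assms(12) that py] by simp
  qed
  ultimately show ?thesis by blast
qed

end
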